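(* Let $\sigma\ge1$, let $\varphi=(\varphi_1,\dots,\varphi_b)$ be a solid $b$-fold $L^*(2,1)$-labeling of $G_{[1,\sigma]}$ with $k$ labels, let $\eta$ be a shading of $\varphi$, and let $(D_i)_{i\in[n]}$ be a sequence of disks with diameters in $[1,\sigma]$. Then algorithm FoldShadeColor with $\varphi,\eta$ on input $(D_i)_{i\in[n]}$ returns an $L(2,1)$-labeling of $G=G((D_i)_{i\in[n]})$ whose largest label does not exceed $k\cdot\left\lfloor\frac{\omega(G)+(b-1)\gamma/2}{b}\right\rfloor$, where $\gamma$ is the maximum number of subtiles in one tile of $\varphi$.
   Context: $G_{[1,\sigma]}$ is the infinite graph on $\mathbb R^2$ with two points adjacent iff their distance lies in $[1,\sigma]$. A solid $b$-fold $k$-coloring of $G_{[1,\sigma]}$ is a tuple $(\varphi_1,\dots,\varphi_b)$ of maps $\mathbb R^2\to$ labels with $\varphi_r(p)\ne\varphi_s(p)$ for $r\ne s$ and $\varphi_r(p_1)\ne\varphi_s(p_2)$ whenever $\mathrm{dist}(p_1,p_2)\in[1,\sigma]$, together with $b$ tilings of the plane into congruent tiles (layers) such that $\varphi_r$ is constant on each tile of layer $r$, any two points of one tile are at distance less than $1$, and distinct tiles of the same color (possibly from different layers) are at distance greater than $\sigma$. It is a solid $b$-fold $L^*(2,1)$-labeling with $k$ labels if: (1) all labels lie in $\{1,\dots,k\}$ or all in $\{0,\dots,k-1\}$; (2) tiles with the same label are at point-to-point distance greater than $2\sigma$; (3) tiles with consecutive labels are at distance greater than $\sigma$; (4) a tile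 with the smallest label and a tile with the largest label are at distance greater than $\sigma$. A subtile is a non-empty intersection of $b$ tiles, one from each layer; a shading is a function $\eta$ from subtiles to $[b]$ such that in every tile each value is taken by the same number of subtiles. For disks $(D_i)$, $G((D_i))$ has one vertex $v_i$ per disk, identified with its center (distinct disks give distinct vertices), with $v_iv_j$ an edge iff the disks intersect; $\omega(G)$ is its clique number. An $L(2,1)$-labeling of a graph is an integer labeling $c$ with $|c(v)-c(w)|\ge2$ for adjacent $v,w$ and $c(v)\ne c(w)$ for $v,w$ at graph distance $2$. Algorithm FoldShadeColor (online): when $D_i$ is read, let $T_r(v_i)$ be the tile of layer $r$ containing $v_i$, $S=\bigcap_rT_r(v_i)$, $m$ the number of earlier vertices in $S$; set $\ell(v_i)=1+((\eta(S)-1+m)\bmod b)$; let $t(v_i)$ be the number of earlier vertices $u$ in $T_{\ell(v_i)}(v_i)$ with $\ell(u)=\ell(v_i)$; assign $c(v_i)=\varphi_{\ell(v_i)}(v_i)+k\,t(v_i)$. *)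

theory Defs
  imports "HOL-Analysis.Analysis" "HOL-Library.Ramsey" "HOL-Library.Extended_Nat"
begin

type_synonym plane = "real ^ 2"

section \<open>Tilings and solid colorings of the plane\<close>

definition congruent_sets :: "plane set \<Rightarrow> plane set \<Rightarrow> bool" where
  "congruent_sets A B \<longleftrightarrow> (\<exists>f. (\<forall>x y. dist (f x) (f y) = dist x y) \<and> f ` A = B)"

text \<open>Every point has to lie in exactly one tile, so boundary points are allotted to one of
  the adjacent tiles, and a tiling is a partition of the plane.\<close>

definition tiling :: "plane set set \<Rightarrow> bool" where
  "tiling \<T> \<longleftrightarrow> partition_on UNIV \<T> \<and> (\<forall>T\<in>\<T>. \<forall>U\<in>\<T>. congruent_sets T U)"

text \<open>The distance between two tiles is read pointwise; the infimum over all pairs of points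
  may be equal to \<open>d\<close>.\<close>

definition farther_than :: "real \<Rightarrow> plane set \<Rightarrow> plane set \<Rightarrow> bool" where
  "farther_than d T U \<longleftrightarrow> (\<forall>p\<in>T. \<forall>q\<in>U. d < dist p q)"

definition range_graph_adj :: "real \<Rightarrow> plane \<Rightarrow> plane \<Rightarrow> bool" where
  "range_graph_adj \<sigma> p q \<longleftrightarrow> dist p q \<in> {1..\<sigma>}"

definition fold_coloring :: "nat \<Rightarrow> nat \<Rightarrow> real \<Rightarrow> (nat \<Rightarrow> plane \<Rightarrow> 'c) \<Rightarrow> bool" where
  "fold_coloring b k \<sigma> \<phi> \<longleftrightarrow>
     b \<ge> 1 \<and>
     (\<exists>C. finite C \<and> card C = k \<and> (\<forall>r\<in>{1..b}. range (\<phi> r) \<subseteq> C)) \<and>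
     (\<forall>r\<in>{1..b}. \<forall>s\<in>{1..b}. \<forall>p. r \<noteq> s \<longrightarrow> \<phi> r p \<noteq> \<phi> s p) \<and>
     (\<forall>r\<in>{1..b}. \<forall>s\<in>{1..b}. \<forall>p q. range_graph_adj \<sigma> p q \<longrightarrow> \<phi> r p \<noteq> \<phi> s q)"

text \<open>For a map that is constant on the nonempty tile \<open>T\<close>, this is its value there.\<close>

definition tile_label :: "(plane \<Rightarrow> 'c) \<Rightarrow> plane set \<Rightarrow> 'c" where
  "tile_label f T = the_elem (f ` T)"

text \<open>\<open>L r\<close> is the tiling of layer \<open>r\<close>; the layers and the components of \<open>\<phi>\<close> are indexed
  by \<open>1, \<dots>, b\<close>.\<close>

definition solid_fold_coloring ::
  "nat \<Rightarrow> nat \<Rightarrow> real \<Rightarrow> (nat \<Rightarrow> plane \<Rightarrow> 'c) \<Rightarrow> (nat \<Rightarrow> plane set set) \<Rightarrow> bool" where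
  "solid_fold_coloring b k \<sigma> \<phi> L \<longleftrightarrow>
     fold_coloring b k \<sigma> \<phi> \<and>
     (\<forall>r\<in>{1..b}. tiling (L r)) \<and>
     (\<forall>r\<in>{1..b}. \<forall>T\<in>L r. \<phi> r constant_on T) \<and>
     (\<forall>r\<in>{1..b}. \<forall>T\<in>L r. \<forall>p\<in>T. \<forall>q\<in>T. dist p q < 1) \<and>
     (\<forall>r\<in>{1..b}. \<forall>s\<in>{1..b}. \<forall>T\<in>L r. \<forall>U\<in>L s.
        (r, T) \<noteq> (s, U) \<and> tile_label (\<phi> r) T = tile_label (\<phi> s) U \<longrightarrow> farther_than \<sigma> T U)"

text \<open>The label set is \<open>{a, \<dots>, a + k - 1}\<close> with \<open>a \<in> {0, 1}\<close>; the smallest and the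
  largest label are those of this set.\<close>

definition solid_Lstar21_labeling ::
  "nat \<Rightarrow> nat \<Rightarrow> real \<Rightarrow> (nat \<Rightarrow> plane \<Rightarrow> int) \<Rightarrow> (nat \<Rightarrow> plane set set) \<Rightarrow> bool" where
  "solid_Lstar21_labeling b k \<sigma> \<phi> L \<longleftrightarrow>
     solid_fold_coloring b k \<sigma> \<phi> L \<and>
     (\<exists>a\<in>{0, 1}.
        (\<forall>r\<in>{1..b}. range (\<phi> r) \<subseteq> {a..a + int k - 1}) \<and>
        (\<forall>r\<in>{1..b}. \<forall>s\<in>{1..b}. \<forall>T\<in>L r. \<forall>U\<in>L s.
           ((r, T) \<noteq> (s, U) \<and> tile_label (\<phi> r) T = tile_label (\<phi> s) U
              \<longrightarrow> farther_than (2 * \<sigma>) T U) \<and>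
           (tile_label (\<phi> s) U = tile_label (\<phi> r) T + 1 \<longrightarrow> farther_than \<sigma> T U) \<and>
           (tile_label (\<phi> r) T = a \<and> tile_label (\<phi> s) U = a + int k - 1
              \<longrightarrow> farther_than \<sigma> T U)))"

section \<open>Subtiles and shadings\<close>

definition subtiles :: "nat \<Rightarrow> (nat \<Rightarrow> plane set set) \<Rightarrow> plane set set" where
  "subtiles b L = {\<Inter>r\<in>{1..b}. T r | T. \<forall>r\<in>{1..b}. T r \<in> L r} - {{}}"

definition subtiles_in :: "nat \<Rightarrow> (nat \<Rightarrow> plane set set) \<Rightarrow> plane set \<Rightarrow> plane set set" where
  "subtiles_in b L T = {S \<in> subtiles b L. S \<subseteq> T}"

text \<open>In a solid labeling with \<open>k\<close> labels, at most \<open>k\<close> tiles of each layer meet a given tile,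
  since such tiles have pairwise different labels. Hence a tile has finitely many subtiles,
  and their number is bounded over all tiles; the cardinalities below and \<open>Max\<close> are proper.\<close>

definition shading :: "nat \<Rightarrow> (nat \<Rightarrow> plane set set) \<Rightarrow> (plane set \<Rightarrow> nat) \<Rightarrow> bool" where
  "shading b L \<eta> \<longleftrightarrow>
     \<eta> ` subtiles b L \<subseteq> {1..b} \<and>
     (\<forall>r\<in>{1..b}. \<forall>T\<in>L r. \<forall>x\<in>{1..b}. \<forall>y\<in>{1..b}.
        card {S \<in> subtiles_in b L T. \<eta> S = x} = card {S \<in> subtiles_in b L T. \<eta> S = y})"

definition max_subtiles :: "nat \<Rightarrow> (nat \<Rightarrow> plane set set) \<Rightarrow> nat" where
  "max_subtiles b L = Max {card (subtiles_in b L T) | r T. r \<in> {1..b} \<and> T \<in> L r}"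

section \<open>Graphs\<close>

text \<open>A graph is given by its vertex set \<open>V\<close> and its set \<open>E\<close> of two-element edges.\<close>

definition clique_number :: "'v set \<Rightarrow> 'v set set \<Rightarrow> nat" where
  "clique_number V E = Max {card K | K. K \<subseteq> V \<and> clique K E}"

text \<open>The length of a shortest walk, \<open>\<infinity>\<close> if there is none.\<close>

definition graph_dist :: "'v set set \<Rightarrow> 'v \<Rightarrow> 'v \<Rightarrow> enat" where
  "graph_dist E u v = (INF m\<in>{m. (u, v) \<in> {(x, y). {x, y} \<in> E} ^^ m}. enat m)"

definition L21_labeling :: "'v set \<Rightarrow> 'v set set \<Rightarrow> ('v \<Rightarrow> int) \<Rightarrow> bool" where
  "L21_labeling V E c \<longleftrightarrow>
     (\<forall>v\<in>V. \<forall>w\<in>V.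
        ({v, w} \<in> E \<longrightarrow> \<bar>c v - c w\<bar> \<ge> 2) \<and>
        (graph_dist E v w = 2 \<longrightarrow> c v \<noteq> c w))"

section \<open>Disk graphs\<close>

text \<open>A disk is a pair of its center and its diameter.\<close>

type_synonym disk = "plane \<times> real"

definition center :: "disk \<Rightarrow> plane" where
  "center D = fst D"

definition diam :: "disk \<Rightarrow> real" where
  "diam D = snd D"

definition disk_region :: "disk \<Rightarrow> plane set" where
  "disk_region D = cball (center D) (diam D / 2)"

text \<open>The vertex of the \<open>i\<close>-th disk is the index \<open>i \<in> {1..n}\<close>, located at \<open>center (D i)\<close>;
  disks with a common center yield different vertices.\<close>

definition disk_graph_edges :: "nat \<Rightarrow> (nat \<Rightarrow> disk) \<Rightarrow> nat set set" where
  "disk_graph_edges n D =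
     {{i, j} | i j. i \<in> {1..n} \<and> j \<in> {1..n} \<and> i \<noteq> j \<and>
        disk_region (D i) \<inter> disk_region (D j) \<noteq> {}}"

section \<open>Algorithm FoldShadeColor\<close>

definition tile_at :: "plane set set \<Rightarrow> plane \<Rightarrow> plane set" where
  "tile_at \<T> p = (THE T. T \<in> \<T> \<and> p \<in> T)"

definition subtile_at :: "nat \<Rightarrow> (nat \<Rightarrow> plane set set) \<Rightarrow> plane \<Rightarrow> plane set" where
  "subtile_at b L p = (\<Inter>r\<in>{1..b}. tile_at (L r) p)"

text \<open>The values at step \<open>i\<close> depend only on the disks \<open>D 1, \<dots>, D i\<close>.\<close>

definition fsc_layer ::
  "nat \<Rightarrow> (nat \<Rightarrow> plane set set) \<Rightarrow> (plane set \<Rightarrow> nat) \<Rightarrow> (nat \<Rightarrow> disk) \<Rightarrow> nat \<Rightarrow> nat" where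
  "fsc_layer b L \<eta> D i =
     (let S = subtile_at b L (center (D i));
          m = card {j \<in> {1..<i}. center (D j) \<in> S}
      in 1 + (\<eta> S - 1 + m) mod b)"

definition fsc_rank ::
  "nat \<Rightarrow> (nat \<Rightarrow> plane set set) \<Rightarrow> (plane set \<Rightarrow> nat) \<Rightarrow> (nat \<Rightarrow> disk) \<Rightarrow> nat \<Rightarrow> nat" where
  "fsc_rank b L \<eta> D i =
     (let l = fsc_layer b L \<eta> D i
      in card {j \<in> {1..<i}. center (D j) \<in> tile_at (L l) (center (D i)) \<and>
                            fsc_layer b L \<eta> D j = l})"

definition FoldShadeColor ::
  "nat \<Rightarrow> nat \<Rightarrow> (nat \<Rightarrow> plane \<Rightarrow> int) \<Rightarrow> (nat \<Rightarrow> plane set set) \<Rightarrow> (plane set \<Rightarrow> nat) \<Rightarrow>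
   (nat \<Rightarrow> disk) \<Rightarrow> nat \<Rightarrow> int" where
  "FoldShadeColor b k \<phi> L \<eta> D i =
     \<phi> (fsc_layer b L \<eta> D i) (center (D i)) + int k * int (fsc_rank b L \<eta> D i)"

end

theory Submission
  imports Defs "HOL-Number_Theory.Cong"
begin

text \<open>
  The label \<open>c i\<close> lies in the residue class of \<open>\<phi>\<close> modulo \<open>k\<close>, and the \<open>L\<^sup>*(2,1)\<close> conditions
  say that the labels of tiles at distance at most \<open>\<sigma>\<close> differ by at least \<open>2\<close> cyclically
  modulo \<open>k\<close>; vertices in the same tile and layer are separated by their ranks.

  For the bound, fix a tile \<open>T\<close> of layer \<open>l\<close> containing \<open>N\<close> centers. These form a clique,
  so \<open>N \<le> \<omega>\<close>. In a subtile \<open>S\<close> of \<open>T\<close> with \<open>m\<close> centers the layers are assigned in cyclic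
  order starting at \<open>\<eta> S\<close>, so that exactly \<open>\<lfloor>(m + f) / b\<rfloor>\<close> of them go to layer \<open>l\<close>, where
  \<open>f = (\<eta> S - 1 - l) mod b\<close>. As the shading is balanced, \<open>f\<close> averages to \<open>(b - 1) / 2\<close> over
  the at most \<open>\<gamma>\<close> subtiles of \<open>T\<close>, so layer \<open>l\<close> gets at most \<open>(N + (b - 1) \<gamma> / 2) / b\<close>
  centers of \<open>T\<close>.
\<close>

section \<open>Residue classes\<close>

lemma le_abs_add_mult_if_abs_between:
  fixes d x y k :: int
  assumes "d \<le> \<bar>x\<bar>" "\<bar>x\<bar> \<le> k - d" "0 \<le> d"
  shows "d \<le> \<bar>x + k * y\<bar>"
proof (cases "y = 0")
  case False
  then have "k * 1 \<le> k * \<bar>y\<bar>" using assms by (intro mult_left_mono) auto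
  then have "k \<le> \<bar>k * y\<bar>" using assms by (simp add: abs_mult)
  with assms show ?thesis by linarith
qed (use assms in simp)

lemma card_dvd_Suc_add_lessThan:
  fixes b f M :: nat
  shows "card {m \<in> {..<M}. b dvd Suc (f + m)} = (f + M) div b - f div b"
proof (induction M)
  case (Suc M)
  have "{m \<in> {..<Suc M}. b dvd Suc (f + m)} =
      (if b dvd Suc (f + M) then insert M {m \<in> {..<M}. b dvd Suc (f + m)}
       else {m \<in> {..<M}. b dvd Suc (f + m)})"
    by (auto simp: less_Suc_eq)
  then have "card {m \<in> {..<Suc M}. b dvd Suc (f + m)} =
      (f + M) div b - f div b + of_bool (b dvd Suc (f + M))"
    using Suc.IH by simp
  moreover have "f div b \<le> (f + M) div b" by (simp add: div_le_mono)
  ultimately show ?case by (simp add: div_Suc dvd_eq_mod_eq_0)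
qed simp

lemma add_mod_eq_iff_dvd_Suc:
  fixes b e m x :: nat
  assumes "x < b"
  shows "(e + m) mod b = x \<longleftrightarrow> b dvd Suc ((e + (b - 1 - x)) mod b + m)"
proof -
  have "(e + m) mod b = x \<longleftrightarrow> [e + m = x] (mod b)" using assms by (simp add: cong_def)
  also have "\<dots> \<longleftrightarrow> [e + m + (b - x) = x + (b - x)] (mod b)"
    by (simp only: cong_add_rcancel_nat)
  also have "e + m + (b - x) = e + (b - 1 - x) + Suc m" using assms by simp
  also have "[\<dots> = x + (b - x)] (mod b) \<longleftrightarrow> (e + (b - 1 - x) + Suc m) mod b = 0"
    using assms by (simp add: cong_def)
  also have "\<dots> \<longleftrightarrow> b dvd Suc ((e + (b - 1 - x)) mod b + m)"
    unfolding dvd_eq_mod_eq_0 by (metis add_Suc_right mod_add_left_eq)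
  finally show ?thesis .
qed

lemma bij_betw_card_less:
  fixes J :: "'a::linorder set"
  assumes "finite J"
  shows "bij_betw (\<lambda>j. card {i \<in> J. i < j}) J {..<card J}"
proof -
  have "card {i \<in> J. i < j} < card {i \<in> J. i < j'}" if "j \<in> J" "j < j'" for j j'
    using assms that by (intro psubset_card_mono) auto
  then have inj: "inj_on (\<lambda>j. card {i \<in> J. i < j}) J"
    by (intro linorder_inj_onI') (auto dest: less_imp_neq)
  have "card {i \<in> J. i < j} < card J" if "j \<in> J" for j
    using assms that by (intro psubset_card_mono) auto
  then have "(\<lambda>j. card {i \<in> J. i < j}) ` J = {..<card J}"
    using inj by (intro card_subset_eq) (auto simp: card_image)
  with inj show ?thesis by (simp add: bij_betw_def)
qed

lemma card_cyclic_assignment: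
  fixes J :: "'a::linorder set" and b e x :: nat
  assumes "finite J" "x < b"
  shows "card {j \<in> J. (e + card {i \<in> J. i < j}) mod b = x} =
    (card J + (e + (b - 1 - x)) mod b) div b"
proof -
  let ?f = "(e + (b - 1 - x)) mod b"
  have "bij_betw (\<lambda>j. card {i \<in> J. i < j}) {j \<in> J. (e + card {i \<in> J. i < j}) mod b = x}
      {m \<in> {..<card J}. (e + m) mod b = x}"
    using bij_betw_card_less[OF assms(1)] by (auto simp: bij_betw_def inj_on_def)
  then have "card {j \<in> J. (e + card {i \<in> J. i < j}) mod b = x} =
      card {m \<in> {..<card J}. b dvd Suc (?f + m)}"
    by (simp only: bij_betw_same_card add_mod_eq_iff_dvd_Suc[OF assms(2)])
  also have "\<dots> = (?f + card J) div b - ?f div b" by (rule card_dvd_Suc_add_lessThan)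
  also have "?f div b = 0" using assms(2) by simp
  finally show ?thesis by (simp add: add.commute)
qed

lemma bij_betw_add_mod:
  fixes b y :: nat
  assumes "b > 0"
  shows "bij_betw (\<lambda>e. (e + y) mod b) {..<b} {..<b}"
proof -
  have "inj_on (\<lambda>e. (e + y) mod b) {..<b}"
    by (intro inj_onI) (metis cong_add_rcancel_nat cong_def lessThan_iff mod_less)
  moreover from this have "(\<lambda>e. (e + y) mod b) ` {..<b} = {..<b}"
    using assms by (intro card_subset_eq) (auto simp: card_image)
  ultimately show ?thesis by (simp add: bij_betw_def)
qed

lemma sum_equal_fibres:
  fixes f :: "'b \<Rightarrow> 'c::comm_semiring_1"
  assumes "finite A" "finite B" "g ` A \<subseteq> B"
    and equal: "\<And>v w. \<lbrakk>v \<in> B; w \<in> B\<rbrakk> \<Longrightarrow> card {x \<in> A. g x = v} = card {x \<in> A. g x = w}"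
  shows "of_nat (card B) * (\<Sum>x\<in>A. f (g x)) = of_nat (card A) * (\<Sum>v\<in>B. f v)"
proof (cases "B = {}")
  case False
  then obtain u where "u \<in> B" by blast
  define N where "N = card {x \<in> A. g x = u}"
  have fibre: "card {x \<in> A. g x = v} = N" if "v \<in> B" for v
    unfolding N_def using that \<open>u \<in> B\<close> by (rule equal)
  have "card A = (\<Sum>v\<in>B. card {x \<in> A. g x = v})"
    using sum.group[OF assms(1-3), of "\<lambda>_. 1::nat"] by simp
  then have card_A: "card A = card B * N" using fibre by simp
  have "(\<Sum>x\<in>A. f (g x)) = (\<Sum>v\<in>B. \<Sum>x\<in>{x \<in> A. g x = v}. f (g x))"
    using sum.group[OF assms(1-3)] by metis
  also have "\<dots> = (\<Sum>v\<in>B. of_nat N * f v)" using fibre by (intro sum.cong) auto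
  finally show ?thesis by (simp add: card_A sum_distrib_left mult.assoc)
qed (use assms in simp)

lemma sum_equal_fibres_mod:
  fixes b y :: nat and \<eta> :: "'s \<Rightarrow> nat"
  assumes "finite A" "b > 0" "\<eta> ` A \<subseteq> {1..b}"
    and "\<And>v w. \<lbrakk>v \<in> {1..b}; w \<in> {1..b}\<rbrakk> \<Longrightarrow> card {S \<in> A. \<eta> S = v} = card {S \<in> A. \<eta> S = w}"
  shows "2 * (\<Sum>S\<in>A. (\<eta> S - 1 + y) mod b) = card A * (b - 1)"
proof -
  have "(\<Sum>v\<in>{1..b}. (v - 1 + y) mod b) = (\<Sum>e<b. (e + y) mod b)"
    by (rule sum.reindex_bij_witness[of _ Suc "\<lambda>v. v - 1"]) auto
  also have "\<dots> = \<Sum>{..<b}" by (rule sum.reindex_bij_betw[OF bij_betw_add_mod]) fact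
  also have "2 * \<dots> = b * (b - 1)"
    using \<open>b > 0\<close> double_gauss_sum[of "b - 1", where 'a = nat]
    by (cases b) (simp_all add: lessThan_Suc_atMost atMost_atLeast0)
  finally have shifts: "2 * (\<Sum>v\<in>{1..b}. (v - 1 + y) mod b) = b * (b - 1)" .
  have "b * (\<Sum>S\<in>A. (\<eta> S - 1 + y) mod b) = card A * (\<Sum>v\<in>{1..b}. (v - 1 + y) mod b)"
    using sum_equal_fibres[OF assms(1) finite_atLeastAtMost assms(3,4),
        of "\<lambda>v. (v - 1 + y) mod b"] by simp
  then have "b * (2 * (\<Sum>S\<in>A. (\<eta> S - 1 + y) mod b)) = b * (card A * (b - 1))"
    using shifts by (metis mult.left_commute)
  then show ?thesis using \<open>b > 0\<close> by simp
qed

section \<open>Graphs\<close>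

lemma card_clique_le_clique_number:
  assumes "finite V" "K \<subseteq> V" "clique K E"
  shows "card K \<le> clique_number V E"
  unfolding clique_number_def
proof (rule Max_ge)
  show "finite {card K |K. K \<subseteq> V \<and> clique K E}"
    by (rule finite_subset[of _ "card ` Pow V"]) (use assms(1) in auto)
qed (use assms in blast)

lemma graph_dist_le:
  assumes "(u, v) \<in> {(x, y). {x, y} \<in> E} ^^ m"
  shows "graph_dist E u v \<le> enat m"
  unfolding graph_dist_def using assms by (intro INF_lower) simp

lemma graph_dist_self: "graph_dist E v v = 0"
proof -
  have "graph_dist E v v \<le> enat 0" by (rule graph_dist_le) simp
  then show ?thesis by (simp flip: zero_enat_def)
qed

lemma relpow_if_graph_dist_eq:
  assumes "graph_dist E u v = enat m"
  shows "(u, v) \<in> {(x, y). {x, y} \<in> E} ^^ m"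
proof -
  let ?lengths = "enat ` {m. (u, v) \<in> {(x, y). {x, y} \<in> E} ^^ m}"
  have "Inf ?lengths = enat m" using assms by (simp add: graph_dist_def)
  then have nonempty: "?lengths \<noteq> {}" by (metis Inf_empty enat.distinct(1) top_enat_def)
  then have "Inf ?lengths = (LEAST l. l \<in> ?lengths)" by (simp only: Inf_enat_def if_False)
  moreover have "(LEAST l. l \<in> ?lengths) \<in> ?lengths" using nonempty by (meson LeastI ex_in_conv)
  ultimately show ?thesis using \<open>Inf ?lengths = enat m\<close> by auto
qed

lemma disk_regions_meet_imp_dist_le:
  assumes "disk_region D \<inter> disk_region D' \<noteq> {}"
  shows "dist (center D) (center D') \<le> (diam D + diam D') / 2"
proof -
  obtain x where "dist (center D) x \<le> diam D / 2" "dist (center D') x \<le> diam D' / 2"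
    using assms by (auto simp: disk_region_def)
  then show ?thesis using dist_triangle2[of "center D" "center D'" x] by argo
qed

lemma disk_regions_meet_if_dist_le:
  assumes "dist (center D) (center D') \<le> diam D" "dist (center D) (center D') \<le> diam D'"
  shows "disk_region D \<inter> disk_region D' \<noteq> {}"
proof -
  have "midpoint (center D) (center D') \<in> disk_region D \<inter> disk_region D'"
    using assms by (simp add: disk_region_def dist_midpoint)
  then show ?thesis by blast
qed

lemma disk_graph_edges_iff:
  "{i, j} \<in> disk_graph_edges n D \<longleftrightarrow> i \<in> {1..n} \<and> j \<in> {1..n} \<and> i \<noteq> j \<and>
    disk_region (D i) \<inter> disk_region (D j) \<noteq> {}"
  unfolding disk_graph_edges_def by (auto simp: doubleton_eq_iff)

section \<open>Tiles and subtiles\<close>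

lemma tile_at_eqI:
  assumes "partition_on UNIV \<T>" "T \<in> \<T>" "p \<in> T"
  shows "tile_at \<T> p = T"
  unfolding tile_at_def
  using assms partition_onD2[OF assms(1)] by (intro the_equality) (auto dest: disjointD)

lemma
  assumes "partition_on UNIV \<T>"
  shows tile_at_in: "tile_at \<T> p \<in> \<T>" and mem_tile_at: "p \<in> tile_at \<T> p"
proof -
  obtain T where "T \<in> \<T>" "p \<in> T" using partition_onD1[OF assms] by blast
  then show "tile_at \<T> p \<in> \<T>" "p \<in> tile_at \<T> p" using tile_at_eqI[OF assms] by auto
qed

locale layered_partition =
  fixes b :: nat and L :: "nat \<Rightarrow> plane set set"
  assumes layer_partition: "r \<in> {1..b} \<Longrightarrow> partition_on UNIV (L r)"
begin

lemmas layer_tile_at_eqI = tile_at_eqI[OF layer_partition]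
  and tile_at_in_layer = tile_at_in[OF layer_partition]
  and mem_layer_tile_at = mem_tile_at[OF layer_partition]

lemma mem_subtile_at: "p \<in> subtile_at b L p"
  by (simp add: subtile_at_def mem_layer_tile_at)

lemma subtile_at_subset_tile_at: "r \<in> {1..b} \<Longrightarrow> subtile_at b L p \<subseteq> tile_at (L r) p"
  by (auto simp: subtile_at_def)

lemma subtile_at_in_subtiles: "subtile_at b L p \<in> subtiles b L"
proof -
  have "\<forall>r\<in>{1..b}. tile_at (L r) p \<in> L r" using tile_at_in_layer by blast
  then have "subtile_at b L p \<in> {\<Inter>r\<in>{1..b}. T r |T. \<forall>r\<in>{1..b}. T r \<in> L r}"
    unfolding subtile_at_def by (intro CollectI exI[of _ "\<lambda>r. tile_at (L r) p"]) simp
  then show ?thesis unfolding subtiles_def using mem_subtile_at[of p] by blast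
qed

lemma subtile_at_eqI:
  assumes "S \<in> subtiles b L" "p \<in> S"
  shows "subtile_at b L p = S"
proof -
  obtain T where "S = (\<Inter>r\<in>{1..b}. T r)" "\<forall>r\<in>{1..b}. T r \<in> L r"
    using assms(1) by (auto simp: subtiles_def)
  moreover from this have "tile_at (L r) p = T r" if "r \<in> {1..b}" for r
    using assms(2) that by (intro layer_tile_at_eqI) auto
  ultimately show ?thesis by (simp add: subtile_at_def)
qed

lemma subtiles_in_eq_image:
  assumes "r \<in> {1..b}" "T \<in> L r"
  shows "subtiles_in b L T = subtile_at b L ` T"
proof
  show "subtile_at b L ` T \<subseteq> subtiles_in b L T"
    using subtile_at_in_subtiles subtile_at_subset_tile_at[OF assms(1)]
      layer_tile_at_eqI[OF assms]
    by (fastforce simp: subtiles_in_def)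
  show "subtiles_in b L T \<subseteq> subtile_at b L ` T"
  proof
    fix S assume S: "S \<in> subtiles_in b L T"
    then obtain p where "p \<in> S" by (auto simp: subtiles_in_def subtiles_def)
    with S show "S \<in> subtile_at b L ` T" using subtile_at_eqI by (force simp: subtiles_in_def)
  qed
qed

lemma card_points_in_tile_eq_sum_subtiles:
  fixes p :: "'i \<Rightarrow> plane"
  assumes r: "r \<in> {1..b}" and T: "T \<in> L r" and "finite J" "finite (subtiles_in b L T)"
  shows "card {j \<in> J. p j \<in> T} = (\<Sum>S\<in>subtiles_in b L T. card {j \<in> J. p j \<in> S})"
proof -
  let ?J = "{j \<in> J. p j \<in> T}" and ?s = "\<lambda>j. subtile_at b L (p j)"
  have "card ?J = (\<Sum>S\<in>subtiles_in b L T. card {j \<in> ?J. ?s j = S})"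
    using sum.group[of ?J "subtiles_in b L T" ?s "\<lambda>_. 1::nat"] assms
    by (force simp: subtiles_in_eq_image[OF r T])
  also have "\<dots> = (\<Sum>S\<in>subtiles_in b L T. card {j \<in> J. p j \<in> S})"
  proof (rule sum.cong[OF refl])
    fix S assume S: "S \<in> subtiles_in b L T"
    have "{j \<in> ?J. ?s j = S} = {j \<in> J. p j \<in> S}"
      using S subtile_at_eqI mem_subtile_at by (fastforce simp: subtiles_in_def)
    then show "card {j \<in> ?J. ?s j = S} = card {j \<in> J. p j \<in> S}" by simp
  qed
  finally show ?thesis .
qed

end

section \<open>Solid colorings\<close>

locale solid_coloring =
  fixes b k :: nat and \<sigma> :: real and \<phi> :: "nat \<Rightarrow> plane \<Rightarrow> 'c" and L :: "nat \<Rightarrow> plane set set"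
  assumes \<sigma>_ge_1: "\<sigma> \<ge> 1"
    and solid: "solid_fold_coloring b k \<sigma> \<phi> L"

sublocale solid_coloring \<subseteq> layered_partition b L
  by unfold_locales (use solid in \<open>auto simp: solid_fold_coloring_def tiling_def\<close>)

context solid_coloring
begin

lemma b_pos: "b > 0"
  using solid by (simp add: solid_fold_coloring_def fold_coloring_def)

lemma colorsE:
  obtains C where "finite C" "card C = k" "\<And>r p. r \<in> {1..b} \<Longrightarrow> \<phi> r p \<in> C"
proof -
  have "\<exists>C. finite C \<and> card C = k \<and> (\<forall>r\<in>{1..b}. range (\<phi> r) \<subseteq> C)"
    using solid by (simp add: solid_fold_coloring_def fold_coloring_def)
  then show ?thesis using that by blast
qed

lemma two_le_k: "k \<ge> 2"
proof -
  obtain C where C: "finite C" "card C = k" "\<And>r p. r \<in> {1..b} \<Longrightarrow> \<phi> r p \<in> C"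
    by (rule colorsE) blast
  have one_mem: "1 \<in> {1..b}" using b_pos by simp
  obtain q :: plane where "norm q = 1" using vector_choose_size[of 1] by auto
  then have "range_graph_adj \<sigma> 0 q" using \<sigma>_ge_1 by (simp add: range_graph_adj_def)
  moreover have "\<forall>p q. range_graph_adj \<sigma> p q \<longrightarrow> \<phi> 1 p \<noteq> \<phi> 1 q"
    using solid one_mem by (simp add: solid_fold_coloring_def fold_coloring_def)
  ultimately have "\<phi> 1 0 \<noteq> \<phi> 1 q" by blast
  then have "card {\<phi> 1 0, \<phi> 1 q} = 2" by simp
  then show ?thesis using card_mono[of C "{\<phi> 1 0, \<phi> 1 q}"] C one_mem by simp
qed

lemma dist_tile_less_1: "\<lbrakk>r \<in> {1..b}; T \<in> L r; p \<in> T; q \<in> T\<rbrakk> \<Longrightarrow> dist p q < 1"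
  using solid by (simp add: solid_fold_coloring_def)

lemma color_eq_if_same_tile:
  assumes "r \<in> {1..b}" "q \<in> tile_at (L r) p"
  shows "\<phi> r q = \<phi> r p"
proof -
  have "\<phi> r constant_on tile_at (L r) p"
    using solid assms(1) tile_at_in_layer by (simp add: solid_fold_coloring_def)
  then show ?thesis
    using assms mem_layer_tile_at unfolding constant_on_def by metis
qed

lemma tile_label_eq:
  assumes "r \<in> {1..b}" "A \<subseteq> tile_at (L r) p" "p \<in> A"
  shows "tile_label (\<phi> r) A = \<phi> r p"
proof -
  have "\<phi> r ` A = {\<phi> r p}" using color_eq_if_same_tile[OF assms(1)] assms(2,3) by fast
  then show ?thesis by (simp add: tile_label_def)
qed

lemma tile_label_tile_at: "r \<in> {1..b} \<Longrightarrow> tile_label (\<phi> r) (tile_at (L r) p) = \<phi> r p"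
  by (simp add: tile_label_eq mem_layer_tile_at)

lemma tile_label_subtile_at: "r \<in> {1..b} \<Longrightarrow> tile_label (\<phi> r) (subtile_at b L p) = \<phi> r p"
  by (rule tile_label_eq[OF _ subtile_at_subset_tile_at mem_subtile_at])

lemma dist_gt_if_farther_than:
  assumes "farther_than d (tile_at (L r) p) (tile_at (L s) q)" "r \<in> {1..b}" "s \<in> {1..b}"
  shows "d < dist p q"
  using assms by (simp add: farther_than_def mem_layer_tile_at)

lemma dist_gt_if_same_color:
  assumes "r \<in> {1..b}" "s \<in> {1..b}" "(r, tile_at (L r) p) \<noteq> (s, tile_at (L s) q)" "\<phi> r p = \<phi> s q"
  shows "\<sigma> < dist p q"
proof (rule dist_gt_if_farther_than[OF _ assms(1,2)])
  show "farther_than \<sigma> (tile_at (L r) p) (tile_at (L s) q)"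
    using solid assms tile_at_in_layer tile_label_tile_at
    unfolding solid_fold_coloring_def by metis
qed

lemma inj_on_subtile_colors:
  assumes r: "r \<in> {1..b}" and T: "T \<in> L r"
  shows "inj_on (\<lambda>S. \<lambda>s\<in>{1..b}. tile_label (\<phi> s) S) (subtiles_in b L T)"
  unfolding subtiles_in_eq_image[OF r T]
proof (rule inj_onI, elim imageE, hypsubst)
  fix p q
  assume p: "p \<in> T" and q: "q \<in> T"
    and eq: "(\<lambda>s\<in>{1..b}. tile_label (\<phi> s) (subtile_at b L p)) =
      (\<lambda>s\<in>{1..b}. tile_label (\<phi> s) (subtile_at b L q))"
  have "tile_at (L s) p = tile_at (L s) q" if s: "s \<in> {1..b}" for s
  proof (rule ccontr)
    assume "tile_at (L s) p \<noteq> tile_at (L s) q"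
    moreover have "\<phi> s p = \<phi> s q"
      using fun_cong[OF eq, of s] s by (simp add: tile_label_subtile_at)
    ultimately have "\<sigma> < dist p q" using dist_gt_if_same_color[OF s s] by simp
    with dist_tile_less_1[OF r T p q] \<sigma>_ge_1 show False by simp
  qed
  then show "subtile_at b L p = subtile_at b L q" by (simp add: subtile_at_def)
qed

lemma
  assumes r: "r \<in> {1..b}" and T: "T \<in> L r"
  shows finite_subtiles_in: "finite (subtiles_in b L T)"
    and card_subtiles_in_le: "card (subtiles_in b L T) \<le> k ^ b"
proof -
  obtain C where C: "finite C" "card C = k" "\<And>r p. r \<in> {1..b} \<Longrightarrow> \<phi> r p \<in> C"
    by (rule colorsE) blast
  let ?colors = "\<lambda>S. \<lambda>s\<in>{1..b}. tile_label (\<phi> s) S" and ?P = "{1..b} \<rightarrow>\<^sub>E C"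
  have finite_P: "finite ?P" using C by (simp add: finite_PiE)
  have colors_in_P: "?colors ` subtiles_in b L T \<subseteq> ?P"
    using C(3) unfolding subtiles_in_eq_image[OF r T]
    by (auto simp: tile_label_subtile_at)
  show "finite (subtiles_in b L T)"
    using inj_on_subtile_colors[OF r T] colors_in_P finite_P by (rule inj_on_finite)
  have "card (subtiles_in b L T) \<le> card ?P"
    using inj_on_subtile_colors[OF r T] colors_in_P finite_P by (rule card_inj_on_le)
  then show "card (subtiles_in b L T) \<le> k ^ b" using C by (simp add: card_PiE)
qed

lemma card_subtiles_in_le_max_subtiles:
  assumes "r \<in> {1..b}" "T \<in> L r"
  shows "card (subtiles_in b L T) \<le> max_subtiles b L"
  unfolding max_subtiles_def
proof (rule Max_ge)
  show "finite {card (subtiles_in b L T) |r T. r \<in> {1..b} \<and> T \<in> L r}"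
    by (rule finite_subset[of _ "{..k ^ b}"]) (use card_subtiles_in_le in auto)
qed (use assms in blast)

end

section \<open>Solid labelings\<close>

locale solid_labeling = solid_coloring b k \<sigma> \<phi> L
  for b k \<sigma> and \<phi> :: "nat \<Rightarrow> plane \<Rightarrow> int" and L +
  assumes labeling: "solid_Lstar21_labeling b k \<sigma> \<phi> L"
begin

lemma dist_gt_if_same_label:
  assumes "r \<in> {1..b}" "s \<in> {1..b}" "(r, tile_at (L r) p) \<noteq> (s, tile_at (L s) q)" "\<phi> r p = \<phi> s q"
  shows "2 * \<sigma> < dist p q"
proof (rule dist_gt_if_farther_than[OF _ assms(1,2)])
  show "farther_than (2 * \<sigma>) (tile_at (L r) p) (tile_at (L s) q)"
    using labeling assms tile_at_in_layer tile_label_tile_at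
    unfolding solid_Lstar21_labeling_def by metis
qed

lemma dist_gt_if_consecutive_labels:
  assumes "r \<in> {1..b}" "s \<in> {1..b}" "\<phi> s q = \<phi> r p + 1"
  shows "\<sigma> < dist p q"
proof (rule dist_gt_if_farther_than[OF _ assms(1,2)])
  show "farther_than \<sigma> (tile_at (L r) p) (tile_at (L s) q)"
    using labeling assms tile_at_in_layer tile_label_tile_at
    unfolding solid_Lstar21_labeling_def by metis
qed

lemma label_rangeE:
  obtains a :: int where "a \<in> {0, 1}" "\<And>r p. r \<in> {1..b} \<Longrightarrow> \<phi> r p \<in> {a..a + int k - 1}"
    "\<And>r s p q. \<lbrakk>r \<in> {1..b}; s \<in> {1..b}; \<phi> r p = a; \<phi> s q = a + int k - 1\<rbrakk> \<Longrightarrow> \<sigma> < dist p q"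
proof -
  obtain a where a: "a \<in> {0, 1}" "\<forall>r\<in>{1..b}. range (\<phi> r) \<subseteq> {a..a + int k - 1}"
    and ends: "\<forall>r\<in>{1..b}. \<forall>s\<in>{1..b}. \<forall>T\<in>L r. \<forall>U\<in>L s.
      tile_label (\<phi> r) T = a \<and> tile_label (\<phi> s) U = a + int k - 1 \<longrightarrow> farther_than \<sigma> T U"
    using labeling unfolding solid_Lstar21_labeling_def by metis
  show ?thesis
  proof (rule that[OF a(1)])
    fix r s p q
    assume rs: "r \<in> {1..b}" "s \<in> {1..b}" and "\<phi> r p = a" "\<phi> s q = a + int k - 1"
    then have "farther_than \<sigma> (tile_at (L r) p) (tile_at (L s) q)"
      using ends tile_at_in_layer tile_label_tile_at by metis
    then show "\<sigma> < dist p q" using rs by (rule dist_gt_if_farther_than)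
  qed (use a(2) in blast)
qed

lemma label_le:
  assumes "r \<in> {1..b}"
  shows "\<phi> r p \<le> int k"
proof -
  obtain a where "a \<in> {0, 1}" "\<phi> r p \<in> {a..a + int k - 1}"
    by (rule label_rangeE) (use assms in blast)
  then show ?thesis by auto
qed

lemma abs_label_diff_less:
  assumes "r \<in> {1..b}" "s \<in> {1..b}"
  shows "\<bar>\<phi> r p - \<phi> s q\<bar> < int k"
proof -
  obtain a where range: "\<And>r p. r \<in> {1..b} \<Longrightarrow> \<phi> r p \<in> {a..a + int k - 1}"
    by (rule label_rangeE) blast
  show ?thesis using range[OF assms(1), of p] range[OF assms(2), of q] by auto
qed

lemma close_labels_cyclically_separated:
  assumes rs: "r \<in> {1..b}" "s \<in> {1..b}" and tiles: "(r, tile_at (L r) p) \<noteq> (s, tile_at (L s) q)"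
    and close: "dist p q \<le> \<sigma>"
  shows "2 \<le> \<bar>\<phi> r p - \<phi> s q\<bar>" "\<bar>\<phi> r p - \<phi> s q\<bar> \<le> int k - 2"
proof -
  obtain a where range: "\<And>r p. r \<in> {1..b} \<Longrightarrow> \<phi> r p \<in> {a..a + int k - 1}"
    and far: "\<And>r s p q. \<lbrakk>r \<in> {1..b}; s \<in> {1..b}; \<phi> r p = a; \<phi> s q = a + int k - 1\<rbrakk>
      \<Longrightarrow> \<sigma> < dist p q"
    by (rule label_rangeE) blast
  have "\<not> (\<phi> r p = a \<and> \<phi> s q = a + int k - 1)" "\<not> (\<phi> s q = a \<and> \<phi> r p = a + int k - 1)"
    using far rs close by (metis dist_commute leD)+
  then show "\<bar>\<phi> r p - \<phi> s q\<bar> \<le> int k - 2"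
    using range[OF rs(1), of p] range[OF rs(2), of q] by auto
  have "\<phi> r p \<noteq> \<phi> s q"
    using dist_gt_if_same_color[OF rs tiles] close by fastforce
  moreover have "\<phi> s q \<noteq> \<phi> r p + 1" "\<phi> r p \<noteq> \<phi> s q + 1"
    using dist_gt_if_consecutive_labels rs close by (metis dist_commute leD)+
  ultimately show "2 \<le> \<bar>\<phi> r p - \<phi> s q\<bar>" by arith
qed

end

section \<open>The algorithm\<close>

locale fold_shade_coloring = solid_coloring +
  fixes \<eta> :: "plane set \<Rightarrow> nat" and D :: "nat \<Rightarrow> disk" and n :: nat
  assumes shading: "shading b L \<eta>"
    and diam: "i \<in> {1..n} \<Longrightarrow> diam (D i) \<in> {1..\<sigma>}"
begin

abbreviation layer :: "nat \<Rightarrow> nat" where "layer \<equiv> fsc_layer b L \<eta> D"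
abbreviation rank :: "nat \<Rightarrow> nat" where "rank \<equiv> fsc_rank b L \<eta> D"
abbreviation pos :: "nat \<Rightarrow> plane" where "pos i \<equiv> center (D i)"
abbreviation tile :: "nat \<Rightarrow> plane set" where "tile i \<equiv> tile_at (L (layer i)) (pos i)"
abbreviation edges :: "nat set set" where "edges \<equiv> disk_graph_edges n D"

definition vertices_in :: "plane set \<Rightarrow> nat set" where
  "vertices_in X = {j \<in> {1..n}. pos j \<in> X}"

definition layer_vertices_in :: "nat \<Rightarrow> plane set \<Rightarrow> nat set" where
  "layer_vertices_in l X = {j \<in> vertices_in X. layer j = l}"

lemma layer_mem: "layer i \<in> {1..b}"
  using b_pos by (auto simp: fsc_layer_def Let_def Suc_le_eq)

lemma pos_mem_tile: "pos i \<in> tile i"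
  by (rule mem_layer_tile_at[OF layer_mem])

lemma rank_less:
  assumes "1 \<le> i" "i < j" "layer i = layer j" "tile i = tile j"
  shows "rank i < rank j"
  unfolding fsc_rank_def Let_def using assms pos_mem_tile[of i]
  by (intro psubset_card_mono) auto

lemma rank_neq:
  assumes "i \<in> {1..n}" "j \<in> {1..n}" "i \<noteq> j" "layer i = layer j" "tile i = tile j"
  shows "rank i \<noteq> rank j"
  using rank_less[of i j] rank_less[of j i] assms by (cases i j rule: linorder_cases) auto

lemma dist_le_if_edge: "{i, j} \<in> edges \<Longrightarrow> dist (pos i) (pos j) \<le> \<sigma>"
  using disk_regions_meet_imp_dist_le[of "D i" "D j"] diam[of i] diam[of j]
  by (force simp: disk_graph_edges_iff)

lemma dist_le_if_graph_dist_2: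
  assumes "graph_dist edges i j = 2"
  shows "dist (pos i) (pos j) \<le> 2 * \<sigma>"
proof -
  have "graph_dist edges i j = enat 2" using assms by (simp add: numeral_eq_enat)
  then have "(i, j) \<in> {(x, y). {x, y} \<in> edges} ^^ 2" by (rule relpow_if_graph_dist_eq)
  then obtain w where "{i, w} \<in> edges" "{w, j} \<in> edges" by (auto simp: numeral_2_eq_2)
  then show ?thesis
    using dist_le_if_edge[of i w] dist_le_if_edge[of w j] dist_triangle[of "pos i" "pos j" "pos w"]
    by linarith
qed

lemma clique_vertices_in_tile:
  assumes "r \<in> {1..b}" "T \<in> L r"
  shows "clique (vertices_in T) edges"
  unfolding clique_def
proof (intro ballI impI)
  fix i j assume ij: "i \<in> vertices_in T" "j \<in> vertices_in T" "i \<noteq> j"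
  then have "dist (pos i) (pos j) < 1"
    using dist_tile_less_1[OF assms] by (simp add: vertices_in_def)
  with ij show "{i, j} \<in> edges"
    using disk_regions_meet_if_dist_le[of "D i" "D j"] diam[of i] diam[of j]
    by (auto simp: disk_graph_edges_iff vertices_in_def)
qed

lemma card_vertices_in_tile_le:
  assumes "r \<in> {1..b}" "T \<in> L r"
  shows "card (vertices_in T) \<le> clique_number {1..n} edges"
  using clique_vertices_in_tile[OF assms]
  by (intro card_clique_le_clique_number) (auto simp: vertices_in_def)

lemma card_layer_vertices_in_subtile:
  assumes S: "S \<in> subtiles b L" and l: "l \<in> {1..b}"
  shows "card (layer_vertices_in l S) = (card (vertices_in S) + (\<eta> S - 1 + (b - l)) mod b) div b"
proof -
  have "layer j = 1 + (\<eta> S - 1 + card {i \<in> vertices_in S. i < j}) mod b"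
    if "j \<in> vertices_in S" for j
  proof -
    have "{i \<in> {1..<j}. pos i \<in> S} = {i \<in> vertices_in S. i < j}"
      using that by (auto simp: vertices_in_def)
    then show ?thesis
      using that subtile_at_eqI[OF S, of "pos j"] by (simp add: fsc_layer_def vertices_in_def)
  qed
  then have "layer_vertices_in l S =
      {j \<in> vertices_in S. (\<eta> S - 1 + card {i \<in> vertices_in S. i < j}) mod b = l - 1}"
    using l by (auto simp: layer_vertices_in_def)
  then show ?thesis
    using l card_cyclic_assignment[of "vertices_in S" "l - 1" b "\<eta> S - 1"]
    by (auto simp: vertices_in_def)
qed

lemma sum_shading_offsets:
  assumes "l \<in> {1..b}" "T \<in> L l"
  shows "2 * (\<Sum>S\<in>subtiles_in b L T. (\<eta> S - 1 + y) mod b) = card (subtiles_in b L T) * (b - 1)"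
proof (rule sum_equal_fibres_mod[OF finite_subtiles_in[OF assms] b_pos])
  show "\<eta> ` subtiles_in b L T \<subseteq> {1..b}"
    using shading by (auto simp: shading_def subtiles_in_def)
  show "card {S \<in> subtiles_in b L T. \<eta> S = v} = card {S \<in> subtiles_in b L T. \<eta> S = w}"
    if "v \<in> {1..b}" "w \<in> {1..b}" for v w
    using shading assms that unfolding shading_def by blast
qed

lemma card_layer_vertices_in_tile_le:
  assumes l: "l \<in> {1..b}" and T: "T \<in> L l"
  shows "2 * (b * card (layer_vertices_in l T))
    \<le> 2 * clique_number {1..n} edges + (b - 1) * max_subtiles b L"
proof -
  let ?A = "subtiles_in b L T" and ?f = "\<lambda>S. (\<eta> S - 1 + (b - l)) mod b"
  note split = card_points_in_tile_eq_sum_subtiles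
    [OF l T _ finite_subtiles_in[OF l T], where p = pos]
  have "card (layer_vertices_in l T) = (\<Sum>S\<in>?A. card (layer_vertices_in l S))"
    using split[of "{j \<in> {1..n}. layer j = l}"]
    by (simp add: layer_vertices_in_def vertices_in_def conj_commute conj_left_commute)
  then have "b * card (layer_vertices_in l T) = (\<Sum>S\<in>?A. b * card (layer_vertices_in l S))"
    by (simp only: sum_distrib_left)
  also have "\<dots> \<le> (\<Sum>S\<in>?A. card (vertices_in S) + ?f S)"
    using card_layer_vertices_in_subtile[OF _ l] by (intro sum_mono) (simp add: subtiles_in_def)
  also have "\<dots> = card (vertices_in T) + (\<Sum>S\<in>?A. ?f S)"
    using split[of "{1..n}"] by (simp add: sum.distrib vertices_in_def)
  finally have "2 * (b * card (layer_vertices_in l T))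
      \<le> 2 * card (vertices_in T) + 2 * (\<Sum>S\<in>?A. ?f S)" by simp
  also have "2 * (\<Sum>S\<in>?A. ?f S) = card ?A * (b - 1)" by (rule sum_shading_offsets[OF l T])
  also have "2 * card (vertices_in T) + card ?A * (b - 1)
      \<le> 2 * clique_number {1..n} edges + (b - 1) * max_subtiles b L"
    using card_vertices_in_tile_le[OF l T] card_subtiles_in_le_max_subtiles[OF l T]
    by (intro add_mono) (simp_all add: mult.commute)
  finally show ?thesis .
qed

lemma rank_less_card_layer_vertices:
  assumes "i \<in> {1..n}"
  shows "rank i < card (layer_vertices_in (layer i) (tile i))"
  unfolding fsc_rank_def Let_def layer_vertices_in_def vertices_in_def
  using assms pos_mem_tile[of i] by (intro psubset_card_mono) auto

lemma rank_plus_1_le_floor: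
  assumes i: "i \<in> {1..n}"
  shows "int (rank i) + 1 \<le>
    \<lfloor>(real (clique_number {1..n} edges) + (real b - 1) * real (max_subtiles b L) / 2) / real b\<rfloor>"
proof -
  let ?\<omega> = "clique_number {1..n} edges" and ?\<gamma> = "max_subtiles b L"
  have "2 * (b * (rank i + 1)) \<le> 2 * (b * card (layer_vertices_in (layer i) (tile i)))"
    using rank_less_card_layer_vertices[OF i] by (intro mult_le_mono2) simp
  also have "\<dots> \<le> 2 * ?\<omega> + (b - 1) * ?\<gamma>"
    by (rule card_layer_vertices_in_tile_le[OF layer_mem tile_at_in_layer[OF layer_mem]])
  finally have "real (2 * (b * (rank i + 1))) \<le> real (2 * ?\<omega> + (b - 1) * ?\<gamma>)"
    by (simp only: of_nat_le_iff)
  then have "real b * (real (rank i) + 1) \<le> real ?\<omega> + (real b - 1) * real ?\<gamma> / 2"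
    using b_pos by (simp add: of_nat_diff Suc_leI distrib_left)
  then have "real (rank i) + 1 \<le> (real ?\<omega> + (real b - 1) * real ?\<gamma> / 2) / real b"
    using b_pos by (simp add: pos_le_divide_eq mult.commute)
  then show ?thesis by (simp add: le_floor_iff)
qed

end

locale fold_shade_labeling = solid_labeling + fold_shade_coloring
begin

abbreviation label :: "nat \<Rightarrow> int" where "label \<equiv> FoldShadeColor b k \<phi> L \<eta> D"

lemma abs_label_diff_ge_2_if_edge:
  assumes edge: "{i, j} \<in> edges"
  shows "2 \<le> \<bar>label i - label j\<bar>"
proof -
  define color_diff where "color_diff = \<phi> (layer i) (pos i) - \<phi> (layer j) (pos j)"
  define rank_diff where "rank_diff = int (rank i) - int (rank j)"
  have diff: "label i - label j = color_diff + int k * rank_diff"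
    by (simp add: FoldShadeColor_def color_diff_def rank_diff_def algebra_simps)
  show ?thesis
  proof (cases "(layer i, tile i) = (layer j, tile j)")
    case True
    then have same: "layer i = layer j" "tile i = tile j" by blast+
    have "color_diff = 0"
      using color_eq_if_same_tile[OF layer_mem, of "pos i" j "pos j"] pos_mem_tile[of i] same
      by (simp add: color_diff_def)
    have "rank_diff \<noteq> 0"
      using rank_neq[OF _ _ _ same] edge by (auto simp: rank_diff_def disk_graph_edges_iff)
    then have "int k * 1 \<le> int k * \<bar>rank_diff\<bar>" by (intro mult_left_mono) auto
    also have "\<dots> = \<bar>label i - label j\<bar>" using diff \<open>color_diff = 0\<close> by (simp add: abs_mult)
    finally show ?thesis using two_le_k by simp
  next
    case False
    note close_labels_cyclically_separated[OF layer_mem layer_mem False dist_le_if_edge[OF edge]]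
    then show ?thesis
      unfolding diff color_diff_def by (rule le_abs_add_mult_if_abs_between) simp
  qed
qed

lemma label_neq_if_graph_dist_2:
  assumes ij: "i \<in> {1..n}" "j \<in> {1..n}" and dist_2: "graph_dist edges i j = 2"
  shows "label i \<noteq> label j"
proof
  assume same_label: "label i = label j"
  have "i \<noteq> j" using dist_2 by (auto simp: graph_dist_self)
  define color_diff where "color_diff = \<phi> (layer i) (pos i) - \<phi> (layer j) (pos j)"
  have color_diff: "color_diff = int k * (int (rank j) - int (rank i))"
    using same_label by (simp add: FoldShadeColor_def color_diff_def algebra_simps)
  then have "int k dvd color_diff" by simp
  moreover have "\<bar>color_diff\<bar> < int k"
    unfolding color_diff_def by (rule abs_label_diff_less[OF layer_mem layer_mem])
  ultimately have "color_diff = 0" using dvd_imp_le_int[of color_diff "int k"] by linarith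
  with color_diff have "rank i = rank j" using two_le_k by simp
  then have "(layer i, tile i) \<noteq> (layer j, tile j)" using rank_neq[OF ij \<open>i \<noteq> j\<close>] by blast
  then have "2 * \<sigma> < dist (pos i) (pos j)"
    using \<open>color_diff = 0\<close>
    by (intro dist_gt_if_same_label[OF layer_mem layer_mem]) (auto simp: color_diff_def)
  with dist_le_if_graph_dist_2[OF dist_2] show False by simp
qed

lemma L21_labeling_label: "L21_labeling {1..n} edges label"
  unfolding L21_labeling_def using abs_label_diff_ge_2_if_edge label_neq_if_graph_dist_2 by blast

lemma label_le_mult_rank: "label i \<le> int k * (int (rank i) + 1)"
  using label_le[OF layer_mem, of i "pos i"] by (simp add: FoldShadeColor_def algebra_simps)

end

theorem mainTheorem15:
  fixes \<sigma> :: real and b k n :: nat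
    and \<phi> :: "nat \<Rightarrow> plane \<Rightarrow> int" and L :: "nat \<Rightarrow> plane set set"
    and \<eta> :: "plane set \<Rightarrow> nat" and D :: "nat \<Rightarrow> disk"
  defines "V \<equiv> {1..n}"
    and "E \<equiv> disk_graph_edges n D"
    and "c \<equiv> FoldShadeColor b k \<phi> L \<eta> D"
    and "\<gamma> \<equiv> max_subtiles b L"
  assumes "\<sigma> \<ge> 1"
    and "solid_Lstar21_labeling b k \<sigma> \<phi> L"
    and "shading b L \<eta>"
    and "\<forall>i\<in>{1..n}. diam (D i) \<in> {1..\<sigma>}"
  shows "L21_labeling V E c \<and>
    (\<forall>i\<in>V. c i \<le> int k * \<lfloor>(real (clique_number V E) + (real b - 1) * real \<gamma> / 2) / real b\<rfloor>)"
proof -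
  interpret fold_shade_labeling b k \<sigma> \<phi> L \<eta> D n
    using assms by unfold_locales (auto simp: solid_Lstar21_labeling_def)
  let ?bound = "\<lfloor>(real (clique_number V E) + (real b - 1) * real \<gamma> / 2) / real b\<rfloor>"
  have "c i \<le> int k * ?bound" if "i \<in> V" for i
  proof -
    have "c i \<le> int k * (int (rank i) + 1)" unfolding c_def by (rule label_le_mult_rank)
    also have "\<dots> \<le> int k * ?bound"
      using rank_plus_1_le_floor that unfolding V_def E_def \<gamma>_def by (intro mult_left_mono) auto
    finally show ?thesis .
  qed
  then show ?thesis using L21_labeling_label unfolding V_def E_def c_def by blast
qed

end
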